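(* For every digraph $\mathcal D$, the fractional local dichromatic number equals the fractional dichromatic number: $$\chi_{LA,f}(\mathcal D)=\chi_{A,f}(\mathcal D).$$ (Consequently, with message passing, one-to-one interference alignment, whose symmetric DoF is $1/\chi_{LA,f}(\mathcal D)$ for conflict digraph $\mathcal D$, boils down to orthogonal access, whose symmetric DoF is $1/\chi_{A,f}(\mathcal D)$.)
   Context: Let $\mathcal D=(\mathcal V,\mathcal A)$ be a finite digraph. $\mathscr A(\mathcal D)$ is the collection of acyclic sets of $\mathcal D$ (vertex sets inducing a sub-digraph with no directed cycle), and $\mathscr A(\mathcal D,v)$ the collection of those containing the vertex $v$. The closed in-neighborhood of $v$ is $\mathcal N_v^-=\{v\}\cup\{u:(u,v)\in\mathcal A\}$. Then $$\chi_{A,f}(\mathcal D)=\min\sum_{A\in\mathscr A(\mathcal D)}g(A),\qquad \chi_{LA,f}(\mathcal D)=\min\max_{v\in\mathcal V}\sum_{A\in\mathscr A(\mathcal D):\,A\cap\mathcal N_v^-\ne\emptyset}g(A),$$ where both minima are over all functions $g:\mathscr A(\mathcal D)\to[0,1]$ with $\sum_{A\in\mathscr A(\mathcal D,v)}g(A)\ge1$ for all $v\in\mathcal V$. *)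

theory Defs
  imports "HOL-Analysis.Function_Topology" "Graph_Theory.Graph_Theory"
begin

definition acyclic_sets :: "('a, 'b) pre_digraph \<Rightarrow> 'a set set" where
  "acyclic_sets D = {A. A \<subseteq> verts D \<and> (\<nexists>p. pre_digraph.cycle (D \<restriction> A) p)}"

definition acyclic_sets_at :: "('a, 'b) pre_digraph \<Rightarrow> 'a \<Rightarrow> 'a set set" where
  "acyclic_sets_at D v = {A \<in> acyclic_sets D. v \<in> A}"

definition closed_in_nbhd :: "('a, 'b) pre_digraph \<Rightarrow> 'a \<Rightarrow> 'a set" where
  "closed_in_nbhd D v = {v} \<union> {u. (u, v) \<in> arcs_ends D}"

text \<open>
  Weightings are total functions on vertex sets, but they are constrained only on the acyclic
  sets, and the objectives below only use their values there.
\<close>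

definition frac_colorings :: "('a, 'b) pre_digraph \<Rightarrow> ('a set \<Rightarrow> real) set" where
  "frac_colorings D =
     {g. (\<forall>A\<in>acyclic_sets D. g A \<in> {0..1}) \<and>
         (\<forall>v\<in>verts D. (\<Sum>A\<in>acyclic_sets_at D v. g A) \<ge> 1)}"

definition total_weight :: "('a, 'b) pre_digraph \<Rightarrow> ('a set \<Rightarrow> real) \<Rightarrow> real" where
  "total_weight D g = (\<Sum>A\<in>acyclic_sets D. g A)"

definition nbhd_weight :: "('a, 'b) pre_digraph \<Rightarrow> ('a set \<Rightarrow> real) \<Rightarrow> 'a \<Rightarrow> real" where
  "nbhd_weight D g v = (\<Sum>A\<in>{A \<in> acyclic_sets D. A \<inter> closed_in_nbhd D v \<noteq> {}}. g A)"

text \<open>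
  The maximum of the neighborhood weights over all vertices. These weights are nonnegative for
  every fractional coloring, so including 0 has no effect unless there are no vertices,
  in which case the maximum is taken to be 0.
\<close>

definition local_weight :: "('a, 'b) pre_digraph \<Rightarrow> ('a set \<Rightarrow> real) \<Rightarrow> real" where
  "local_weight D g = Max (insert 0 (nbhd_weight D g ` verts D))"

text \<open>
  Both numbers are minima, hence \<^const>\<open>Least\<close>; that the minima exist for every finite loopless
  digraph is proved below.
\<close>

definition frac_dichromatic :: "('a, 'b) pre_digraph \<Rightarrow> real" where
  "frac_dichromatic D = (LEAST x. x \<in> total_weight D ` frac_colorings D)"

definition frac_local_dichromatic :: "('a, 'b) pre_digraph \<Rightarrow> real" where
  "frac_local_dichromatic D = (LEAST x. x \<in> local_weight D ` frac_colorings D)"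


lemma local_weight_eq_Max:
  assumes "digraph D" "verts D \<noteq> {}" "g \<in> frac_colorings D"
  shows "local_weight D g = Max (nbhd_weight D g ` verts D)"
proof -
  interpret digraph D by fact
  have nn: "nbhd_weight D g v \<ge> 0" for v
    using assms(3) unfolding nbhd_weight_def frac_colorings_def by (intro sum_nonneg) auto
  obtain v where v: "v \<in> verts D" using assms(2) by blast
  have "Max (nbhd_weight D g ` verts D) \<ge> nbhd_weight D g v"
    using v by (intro Max_ge) auto
  with nn[of v] have "Max (nbhd_weight D g ` verts D) \<ge> 0" by linarith
  then show ?thesis
    unfolding local_weight_def using assms(2) by (subst Max_insert) auto
qed

lemma finite_acyclic_sets:
  assumes "digraph D"
  shows "finite (acyclic_sets D)"
proof -
  interpret digraph D by fact
  have "acyclic_sets D \<subseteq> Pow (verts D)" by (auto simp: acyclic_sets_def)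
  then show ?thesis by (rule finite_subset) simp
qed

lemma singleton_acyclic:
  assumes "digraph D" "v \<in> verts D"
  shows "{v} \<in> acyclic_sets D"
proof -
  interpret digraph D by fact
  have "\<not> pre_digraph.cycle (D \<restriction> {v}) p" for p
  proof
    assume "pre_digraph.cycle (D \<restriction> {v}) p"
    then obtain u where "pre_digraph.awalk (D \<restriction> {v}) u p u" "p \<noteq> []"
      unfolding pre_digraph.cycle_def by blast
    then have "arcs (D \<restriction> {v}) \<noteq> {}"
      unfolding pre_digraph.awalk_def by (cases p) auto
    then show False by (auto simp: induce_subgraph_def dest: no_loops)
  qed
  then show ?thesis using assms(2) by (auto simp: acyclic_sets_def)
qed

lemma frac_colorings_nonempty:
  assumes "digraph D"
  shows "(\<lambda>A. 1) \<in> frac_colorings D"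
proof -
  have "1 \<le> card (acyclic_sets_at D v)" if "v \<in> verts D" for v
  proof -
    have "{v} \<in> acyclic_sets_at D v"
      using singleton_acyclic[OF assms that] by (simp add: acyclic_sets_at_def)
    moreover have "finite (acyclic_sets_at D v)"
      using finite_acyclic_sets[OF assms] by (simp add: acyclic_sets_at_def)
    ultimately show ?thesis
      by (metis One_nat_def Suc_leI card_gt_0_iff empty_iff)
  qed
  then show ?thesis by (auto simp: frac_colorings_def)
qed

lemma frac_colorings_attain_min:
  assumes "digraph D"
    and cont: "continuous_on UNIV f"
    and cong: "\<And>g h. (\<And>A. A \<in> acyclic_sets D \<Longrightarrow> g A = h A) \<Longrightarrow> f g = (f h :: real)"
  shows "\<exists>g\<in>frac_colorings D. \<forall>h\<in>frac_colorings D. f g \<le> f h"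
proof -
  define B where "B = (\<lambda>A. if A \<in> acyclic_sets D then {0..1::real} else {0})"
  define C where "C = {g :: 'a set \<Rightarrow> real. \<forall>v\<in>verts D. 1 \<le> (\<Sum>A\<in>acyclic_sets_at D v. g A)}"
  have "compactin (product_topology (\<lambda>_. euclidean) UNIV) (PiE UNIV B)"
    unfolding compactin_PiE by (auto simp: B_def)
  then have "compact (PiE UNIV B)"
    by (simp add: euclidean_product_topology)
  moreover have "closed C"
  proof -
    have "C = (\<Inter>v\<in>verts D. {g. 1 \<le> (\<Sum>A\<in>acyclic_sets_at D v. g A)})"
      by (auto simp: C_def)
    then show ?thesis
      by (auto intro!: closed_INT closed_Collect_le continuous_on_sum)
  qed
  ultimately have comp: "compact (PiE UNIV B \<inter> C)" by (rule compact_Int_closed)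
  define r where "r = (\<lambda>(g :: 'a set \<Rightarrow> real) A. if A \<in> acyclic_sets D then g A else 0)"
  have r: "r g \<in> PiE UNIV B \<inter> C" if "g \<in> frac_colorings D" for g
  proof -
    have "sum (r g) (acyclic_sets_at D v) = sum g (acyclic_sets_at D v)" for v
      by (intro sum.cong) (auto simp: r_def acyclic_sets_at_def)
    then show ?thesis
      using that by (auto simp: frac_colorings_def r_def B_def C_def PiE_def Pi_def)
  qed
  have sub: "PiE UNIV B \<inter> C \<subseteq> frac_colorings D"
    by (auto simp: frac_colorings_def B_def C_def PiE_def Pi_def split: if_splits)
  have "PiE UNIV B \<inter> C \<noteq> {}" using r[OF frac_colorings_nonempty[OF assms(1)]] by auto
  then obtain g where g: "g \<in> PiE UNIV B \<inter> C" "\<And>h. h \<in> PiE UNIV B \<inter> C \<Longrightarrow> f g \<le> f h"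
    using continuous_attains_inf[OF comp _ continuous_on_subset[OF cont]] by blast
  have "f g \<le> f h" if "h \<in> frac_colorings D" for h
  proof -
    have "f (r h) = f h" by (rule cong) (simp add: r_def)
    then show ?thesis using g(2)[OF r[OF that]] by simp
  qed
  then show ?thesis using g(1) sub by blast
qed

lemma continuous_on_Max_insert:
  fixes F :: "'v \<Rightarrow> 'g::topological_space \<Rightarrow> real"
  assumes "finite V" "\<And>v. v \<in> V \<Longrightarrow> continuous_on UNIV (F v)"
  shows "continuous_on UNIV (\<lambda>g. Max (insert 0 ((\<lambda>v. F v g) ` V)))"
  using assms
proof (induction V rule: finite_induct)
  case empty
  then show ?case by simp
next
  case (insert v V)
  have "Max (insert 0 ((\<lambda>v. F v g) ` insert v V))
      = max (F v g) (Max (insert 0 ((\<lambda>v. F v g) ` V)))" for g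
    using insert.hyps(1) by (simp add: insert_commute[of 0 "F v g"])
  then show ?case
    using insert by (simp only:) (auto intro!: continuous_on_max)
qed

lemma Least_image:
  fixes f :: "'c \<Rightarrow> real"
  assumes "\<exists>g\<in>S. \<forall>h\<in>S. f g \<le> f h"
  shows "\<exists>g\<in>S. (LEAST x. x \<in> f ` S) = f g \<and> (\<forall>h\<in>S. f g \<le> f h)"
proof -
  obtain g where "g \<in> S" "\<forall>h\<in>S. f g \<le> f h" using assms by blast
  moreover from this have "(LEAST x. x \<in> f ` S) = f g" by (intro Least_equality) auto
  ultimately show ?thesis by blast
qed

theorem frac_dichromatic_is_min:
  assumes "digraph D"
  shows "\<exists>g\<in>frac_colorings D. frac_dichromatic D = total_weight D g \<and>
           (\<forall>h\<in>frac_colorings D. total_weight D g \<le> total_weight D h)"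
  unfolding frac_dichromatic_def
proof (rule Least_image, rule frac_colorings_attain_min[OF assms])
  show "continuous_on UNIV (total_weight D)"
    unfolding total_weight_def by (intro continuous_on_sum) auto
qed (auto simp: total_weight_def intro: sum.cong)

theorem frac_local_dichromatic_is_min:
  assumes "digraph D"
  shows "\<exists>g\<in>frac_colorings D. frac_local_dichromatic D = local_weight D g \<and>
           (\<forall>h\<in>frac_colorings D. local_weight D g \<le> local_weight D h)"
  unfolding frac_local_dichromatic_def
proof (rule Least_image, rule frac_colorings_attain_min[OF assms])
  interpret digraph D by fact
  have "continuous_on UNIV (\<lambda>g. nbhd_weight D g v)" for v
    unfolding nbhd_weight_def by (intro continuous_on_sum) auto
  then show "continuous_on UNIV (local_weight D)"
    unfolding local_weight_def by (intro continuous_on_Max_insert) auto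
next
  fix g h :: "'a set \<Rightarrow> real"
  assume "\<And>A. A \<in> acyclic_sets D \<Longrightarrow> g A = h A"
  then have "nbhd_weight D g = nbhd_weight D h"
    by (auto simp: nbhd_weight_def fun_eq_iff intro!: sum.cong)
  then show "local_weight D g = local_weight D h" by (simp add: local_weight_def)
qed

end

theory Submission
  imports Defs "HOL-Combinatorics.Multiset_Permutations"
begin

text \<open>
  Given a fractional coloring g whose neighborhood weights are at most L, order the acyclic sets
  of positive weight by sampling them without replacement with probability proportional to g.
  Keep a vertex v if the first set in this order that meets the closed in-neighborhood of v
  contains v. Along an arc (u, v) between kept vertices, the set belonging to v comes no later
  than the set belonging to u, because the latter contains u; on a directed cycle all these sets
  therefore coincide, and so the kept vertices form an acyclic set. A vertex is kept with
  probability at least 1/L, so L times the distribution of the random set of kept vertices,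
  cut off at 1, is a fractional coloring of total weight at most L.
\<close>

section \<open>Weighted random permutations\<close>

text \<open>For distinct entries of positive weight this is the probability of drawing them in this
  order without replacement (the Plackett-Luce model); the denominator is the weight not yet
  drawn.\<close>

primrec sampling_weight :: "('c \<Rightarrow> real) \<Rightarrow> 'c list \<Rightarrow> real" where
  "sampling_weight w [] = 1"
| "sampling_weight w (x # xs) = w x / sum w (set (x # xs)) * sampling_weight w xs"

declare sampling_weight.simps(2) [simp del]

lemma sampling_weight_nonneg:
  assumes "\<And>x. x \<in> set xs \<Longrightarrow> 0 \<le> w x"
  shows "0 \<le> sampling_weight w xs"
  using assms
  by (induction xs) (auto simp: sampling_weight.simps intro!: mult_nonneg_nonneg divide_nonneg_nonneg sum_nonneg)

lemma sum_permutations_of_set_Cons: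
  assumes "finite F" "F \<noteq> {}"
  shows "sum f (permutations_of_set F) = (\<Sum>x\<in>F. \<Sum>xs\<in>permutations_of_set (F - {x}). f (x # xs))"
proof -
  have "sum f (permutations_of_set F)
      = (\<Sum>x\<in>F. sum f ((#) x ` permutations_of_set (F - {x})))"
    using assms by (subst permutations_of_set_nonempty) (auto intro!: sum.UNION_disjoint)
  also have "\<dots> = (\<Sum>x\<in>F. \<Sum>xs\<in>permutations_of_set (F - {x}). f (x # xs))"
    by (simp add: sum.reindex)
  finally show ?thesis .
qed

text \<open>Conditioning on the first draw: the remaining draws follow the same law on
  \<open>F - {x}\<close>. The next two inductions rest on this.\<close>

lemma sum_sampling_weight_Cons:
  assumes "finite F" "F \<noteq> {}"
  shows "(\<Sum>xs\<in>permutations_of_set F. sampling_weight w xs * f xs)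
       = (\<Sum>x\<in>F. w x * (\<Sum>xs\<in>permutations_of_set (F - {x}). sampling_weight w xs * f (x # xs)))
         / sum w F"
proof -
  have "sampling_weight w (x # xs) * f (x # xs)
      = w x * (sampling_weight w xs * f (x # xs)) / sum w F"
    if "x \<in> F" "xs \<in> permutations_of_set (F - {x})" for x xs
  proof -
    have "set (x # xs) = F" using that by (auto dest: permutations_of_setD)
    then show ?thesis by (simp only: sampling_weight.simps) simp
  qed
  then show ?thesis
    unfolding sum_permutations_of_set_Cons[OF assms] sum_divide_distrib sum_distrib_left
    by (intro sum.cong refl) blast
qed

lemma sum_sampling_weight:
  assumes "finite F" "\<And>x. x \<in> F \<Longrightarrow> 0 < w x"
  shows "(\<Sum>xs\<in>permutations_of_set F. sampling_weight w xs) = 1"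
  using assms
proof (induction F rule: finite_remove_induct)
  case empty
  then show ?case by simp
next
  case (remove F)
  have "sum w F > 0" using remove by (intro sum_pos) auto
  moreover have "(\<Sum>x\<in>F. w x * (\<Sum>xs\<in>permutations_of_set (F - {x}). sampling_weight w xs)) = sum w F"
    using remove by (intro sum.cong) auto
  ultimately show ?case
    using sum_sampling_weight_Cons[OF remove.hyps(1,2), of w "\<lambda>_. 1"] by simp
qed

text \<open>Draws failing \<open>Q\<close> do not influence which element satisfying
  \<open>Q\<close> comes first, so that element is distributed proportionally to \<open>w\<close> on
  \<open>{x \<in> F. Q x}\<close>.\<close>

lemma sum_sampling_weight_find:
  assumes "finite F" "\<And>x. x \<in> F \<Longrightarrow> 0 < w x" "\<exists>x\<in>F. Q x"
  shows "(\<Sum>xs\<in>permutations_of_set F.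
            sampling_weight w xs * of_bool (\<exists>x. find Q xs = Some x \<and> U x))
       = sum w {x \<in> F. Q x \<and> U x} / sum w {x \<in> F. Q x}"
  using assms
proof (induction F rule: finite_remove_induct)
  case empty
  then show ?case by simp
next
  case (remove F)
  let ?r = "sum w {x \<in> F. Q x \<and> U x} / sum w {x \<in> F. Q x}"
  have pos: "sum w {x \<in> F. Q x} > 0"
    using remove.hyps remove.prems by (intro sum_pos) auto
  have nonneg: "sum w {x \<in> F. \<not> Q x} \<ge> 0"
    using remove.prems by (intro sum_nonneg) (auto intro: less_imp_le)
  have split: "sum w F = sum w {x \<in> F. Q x} + sum w {x \<in> F. \<not> Q x}"
    using sum.Int_Diff[of F w "{x. Q x}"] remove.hyps(1)
    by (simp add: Int_def set_diff_eq)
  \<comment> \<open>A first draw satisfying \<open>Q\<close> decides the event; any other leaves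
    both sums in \<open>?r\<close> unchanged.\<close>
  have inner: "(\<Sum>xs\<in>permutations_of_set (F - {x}).
       sampling_weight w xs * of_bool (\<exists>y. find Q (x # xs) = Some y \<and> U y))
     = (if Q x then of_bool (U x) else ?r)" if x: "x \<in> F" for x
  proof (cases "Q x")
    case True
    then show ?thesis
      using sum_sampling_weight[of "F - {x}" w] remove.hyps remove.prems
      by (simp flip: sum_distrib_right)
  next
    case False
    then have "{y \<in> F - {x}. Q y} = {y \<in> F. Q y}" "{y \<in> F - {x}. Q y \<and> U y} = {y \<in> F. Q y \<and> U y}"
      by auto
    moreover have "\<exists>y\<in>F - {x}. Q y" using remove.prems False by auto
    ultimately show ?thesis using remove.IH[OF x] remove.prems False by simp
  qed
  have "(\<Sum>x\<in>F. w x * (if Q x then of_bool (U x) else ?r))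
      = (\<Sum>x\<in>F. (if Q x \<and> U x then w x else 0) + (if \<not> Q x then w x * ?r else 0))"
    by (intro sum.cong) auto
  also have "\<dots> = sum w {x \<in> F. Q x \<and> U x} + sum w {x \<in> F. \<not> Q x} * ?r"
    unfolding sum.distrib sum_distrib_right sum.inter_filter[OF remove.hyps(1)]
    by (intro arg_cong2[where f = plus] sum.cong) auto
  also have "\<dots> = ?r * sum w F"
    using pos by (simp add: split field_simps)
  finally have "(\<Sum>x\<in>F. w x * (\<Sum>xs\<in>permutations_of_set (F - {x}).
       sampling_weight w xs * of_bool (\<exists>y. find Q (x # xs) = Some y \<and> U y))) = ?r * sum w F"
    by (simp only: inner cong: sum.cong)
  moreover have "sum w F \<noteq> 0" using pos nonneg split by linarith
  ultimately show ?case
    by (simp only: sum_sampling_weight_Cons[OF remove.hyps(1,2)] nonzero_mult_div_cancel_right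
        not_False_eq_True)
qed

section \<open>Acyclic sets\<close>

text \<open>A closed walk with at least one arc contains a cycle. This replaces cycles by transitive
  closures, which are easier to split up along a vertex set.\<close>

lemma (in wf_digraph) acyclic_iff_no_cycle: "acyclic (arcs_ends G) \<longleftrightarrow> (\<nexists>p. cycle p)"
proof
  assume "acyclic (arcs_ends G)"
  then show "\<nexists>p. cycle p"
    unfolding acyclic_def cycle_def using reachable1_awalk by blast
next
  assume "\<nexists>p. cycle p"
  then show "acyclic (arcs_ends G)"
    unfolding acyclic_def reachable1_awalk
    using closed_w_imp_cycle by (auto simp: closed_w_def)
qed

lemma acyclic_sets_iff:
  assumes "digraph D"
  shows "A \<in> acyclic_sets D \<longleftrightarrow> A \<subseteq> verts D \<and> acyclic (arcs_ends D \<inter> A \<times> A)"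
proof -
  interpret digraph D by fact
  have "arcs_ends (D \<restriction> A) = arcs_ends D \<inter> A \<times> A"
    by (auto simp: arcs_ends_conv induce_subgraph_def)
  moreover have "wf_digraph (D \<restriction> A)" if "A \<subseteq> verts D"
    using that by (unfold_locales) (auto simp: induce_subgraph_def)
  ultimately show ?thesis
    unfolding acyclic_sets_def using wf_digraph.acyclic_iff_no_cycle by fastforce
qed

text \<open>By \<open>closed\<close>, a walk inside \<open>C\<close> that enters \<open>A\<close>
  never leaves it, so a directed cycle in \<open>C\<close> lies either within \<open>A\<close> or
  within \<open>C - A\<close>.\<close>

lemma acyclic_Int_Times_closed_part:
  assumes "acyclic (E \<inter> A \<times> A)" "acyclic (E \<inter> (C - A) \<times> (C - A))"
    and closed: "\<And>u v. (u, v) \<in> E \<Longrightarrow> u \<in> C \<inter> A \<Longrightarrow> v \<in> C \<Longrightarrow> v \<in> A"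
  shows "acyclic (E \<inter> C \<times> C)"
proof -
  let ?R = "E \<inter> C \<times> C"
  have in_A: "(x, y) \<in> (E \<inter> A \<times> A)\<^sup>+ \<and> y \<in> A" if "(x, y) \<in> ?R\<^sup>+" "x \<in> A" for x y
    using that
  proof (induction rule: trancl_induct)
    case (base y)
    then show ?case using closed by auto
  next
    case (step y z)
    then have "(y, z) \<in> E \<inter> A \<times> A" using closed by auto
    then show ?case using step by (auto intro: trancl_into_trancl)
  qed
  \<comment> \<open>The induction runs backwards from the endpoint: a walk ending outside
    \<open>A\<close> cannot have visited \<open>A\<close> before.\<close>
  have out_A: "(x, y) \<in> (E \<inter> (C - A) \<times> (C - A))\<^sup>+" if "(x, y) \<in> ?R\<^sup>+" "y \<notin> A" for x y
    using that
  proof (induction rule: converse_trancl_induct)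
    case (base x)
    then show ?case using closed by auto
  next
    case (step x z)
    have "z \<notin> A" using in_A[OF step.hyps(2)] step.prems by blast
    then have "(x, z) \<in> E \<inter> (C - A) \<times> (C - A)" using step.hyps(1) closed by auto
    then show ?case using step by (auto intro: trancl_into_trancl2)
  qed
  show ?thesis
    using assms(1,2) in_A out_A unfolding acyclic_def by blast
qed

text \<open>The kept vertices for the order \<open>As\<close>. A vertex whose closed in-neighborhood
  meets no set of \<open>As\<close> gets \<open>None\<close> from \<open>find\<close> and is not
  kept.\<close>

definition first_hit_set :: "('a, 'b) pre_digraph \<Rightarrow> 'a set list \<Rightarrow> 'a set" where
  "first_hit_set D As =
     {v \<in> verts D. \<exists>A. find (\<lambda>A. A \<inter> closed_in_nbhd D v \<noteq> {}) As = Some A \<and> v \<in> A}"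

text \<open>Induction on the list: the head \<open>A\<close> splits the kept vertices into an
  acyclic part that arcs cannot leave and vertices that the tail alone would keep.\<close>

lemma first_hit_set_acyclic:
  assumes "digraph D" "set As \<subseteq> acyclic_sets D"
  shows "first_hit_set D As \<in> acyclic_sets D"
proof -
  have "acyclic (arcs_ends D \<inter> first_hit_set D As \<times> first_hit_set D As)"
    using assms(2)
  proof (induction As)
    case Nil
    then show ?case by (simp add: first_hit_set_def acyclic_def)
  next
    case (Cons A As)
    let ?C = "first_hit_set D (A # As)"
    have "acyclic (arcs_ends D \<inter> A \<times> A)"
      using Cons.prems acyclic_sets_iff[OF assms(1)] by simp
    moreover have "acyclic (arcs_ends D \<inter> (?C - A) \<times> (?C - A))"
    proof (rule acyclic_subset)
      show "acyclic (arcs_ends D \<inter> first_hit_set D As \<times> first_hit_set D As)"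
        using Cons by simp
      have "?C - A \<subseteq> first_hit_set D As"
        by (auto simp: first_hit_set_def split: if_splits)
      then show "arcs_ends D \<inter> (?C - A) \<times> (?C - A)
          \<subseteq> arcs_ends D \<inter> first_hit_set D As \<times> first_hit_set D As"
        by blast
    qed
    moreover have "v \<in> A" if "(u, v) \<in> arcs_ends D" "u \<in> ?C \<inter> A" "v \<in> ?C" for u v
    proof -
      \<comment> \<open>The vertex \<open>u\<close> lies in \<open>A\<close> and in the closed
        in-neighborhood of \<open>v\<close>, so \<open>A\<close> is the first hit of
        \<open>v\<close>.\<close>
      have "A \<inter> closed_in_nbhd D v \<noteq> {}" using that by (auto simp: closed_in_nbhd_def)
      then show ?thesis using that(3) by (simp add: first_hit_set_def)
    qed
    ultimately show ?case by (rule acyclic_Int_Times_closed_part)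
  qed
  then show ?thesis
    unfolding acyclic_sets_iff[OF assms(1)] by (auto simp: first_hit_set_def)
qed

section \<open>Fractional colorings\<close>

lemma nbhd_weight_le_local_weight:
  assumes "digraph D" "v \<in> verts D"
  shows "nbhd_weight D g v \<le> local_weight D g"
proof -
  interpret digraph D by fact
  show ?thesis unfolding local_weight_def using assms(2) by (intro Max_ge) auto
qed

lemma local_weight_le_total_weight:
  assumes "digraph D" "g \<in> frac_colorings D"
  shows "local_weight D g \<le> total_weight D g"
proof -
  interpret digraph D by fact
  have nonneg: "0 \<le> g A" if "A \<in> acyclic_sets D" for A
    using assms(2) that by (simp add: frac_colorings_def)
  have "nbhd_weight D g v \<le> total_weight D g" for v
    unfolding nbhd_weight_def total_weight_def
    using finite_acyclic_sets[OF assms(1)] nonneg by (intro sum_mono2) auto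
  \<comment> \<open>The \<open>0\<close> inserted in the maximum has to be bounded as well.\<close>
  moreover have "0 \<le> total_weight D g"
    unfolding total_weight_def using nonneg by (intro sum_nonneg)
  ultimately show ?thesis
    unfolding local_weight_def by (subst Max_le_iff) auto
qed

text \<open>A set with \<open>1 \<le> h A\<close> still covers its vertices alone after the cutoff;
  if no such set contains \<open>v\<close>, the cutoff changes nothing at \<open>v\<close>.\<close>

lemma frac_coloring_cutoff:
  assumes "digraph D"
    and nonneg: "\<And>A. A \<in> acyclic_sets D \<Longrightarrow> 0 \<le> h A"
    and cover: "\<And>v. v \<in> verts D \<Longrightarrow> 1 \<le> sum h (acyclic_sets_at D v)"
  shows "(\<lambda>A. min 1 (h A)) \<in> frac_colorings D"
proof -
  have "1 \<le> (\<Sum>A\<in>acyclic_sets_at D v. min 1 (h A))" if v: "v \<in> verts D" for v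
  proof (cases "\<exists>A\<in>acyclic_sets_at D v. 1 \<le> h A")
    case True
    then obtain A where A: "A \<in> acyclic_sets_at D v" "1 \<le> h A" by blast
    have "finite (acyclic_sets_at D v)"
      using finite_acyclic_sets[OF assms(1)] by (simp add: acyclic_sets_at_def)
    then have "min 1 (h A) \<le> (\<Sum>A\<in>acyclic_sets_at D v. min 1 (h A))"
      using A nonneg by (intro member_le_sum) (auto simp: acyclic_sets_at_def)
    then show ?thesis using A by simp
  next
    case False
    then have "(\<Sum>A\<in>acyclic_sets_at D v. min 1 (h A)) = sum h (acyclic_sets_at D v)"
      by (intro sum.cong) (auto simp: min_def)
    then show ?thesis using cover[OF v] by simp
  qed
  then show ?thesis using nonneg by (auto simp: frac_colorings_def)
qed

lemma exists_frac_coloring_total_weight_le: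
  assumes "digraph D" and g: "g \<in> frac_colorings D"
  shows "\<exists>h\<in>frac_colorings D. total_weight D h \<le> local_weight D g"
proof -
  interpret digraph D by fact
  define L where "L = local_weight D g"
  \<comment> \<open>Only sets of positive weight are sampled, which keeps every denominator
    positive.\<close>
  define F where "F = {A \<in> acyclic_sets D. 0 < g A}"
  define P where "P = permutations_of_set F"
  \<comment> \<open>\<open>h S\<close> is \<open>L\<close> times the probability that the kept
    vertices form \<open>S\<close>.\<close>
  define h where "h = (\<lambda>S. \<Sum>As | As \<in> P \<and> first_hit_set D As = S. L * sampling_weight g As)"
  note fin = finite_acyclic_sets[OF assms(1)]
  have finF: "finite F" using fin by (simp add: F_def)
  have finP: "finite P" by (simp add: P_def)
  have L_nonneg: "0 \<le> L" unfolding L_def local_weight_def by (intro Max_ge) auto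
  have zero: "g A = 0" if "A \<in> acyclic_sets D - F" for A
    using g that by (force simp: F_def frac_colorings_def)
  have wt_nonneg: "0 \<le> L * sampling_weight g As" if "As \<in> P" for As
    using that L_nonneg
    by (intro mult_nonneg_nonneg sampling_weight_nonneg)
       (auto simp: P_def F_def dest: permutations_of_setD)
  have hit_acyclic: "first_hit_set D As \<in> acyclic_sets D" if "As \<in> P" for As
    using that by (intro first_hit_set_acyclic[OF assms(1)]) (auto simp: P_def F_def dest: permutations_of_setD)
  have h_nonneg: "0 \<le> h S" for S
    unfolding h_def using wt_nonneg by (intro sum_nonneg) auto
  have total: "total_weight D h = L"
  proof -
    have "total_weight D h = (\<Sum>As\<in>P. L * sampling_weight g As)"
      unfolding total_weight_def h_def using finP fin hit_acyclic by (intro sum.group) auto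
    also have "\<dots> = L"
      using sum_sampling_weight[OF finF, of g] by (simp add: P_def F_def flip: sum_distrib_left)
    finally show ?thesis .
  qed
  have cover: "1 \<le> sum h (acyclic_sets_at D v)" if v: "v \<in> verts D" for v
  proof -
    let ?Q = "\<lambda>A. A \<inter> closed_in_nbhd D v \<noteq> {}"
    have v_nbhd: "v \<in> closed_in_nbhd D v" by (simp add: closed_in_nbhd_def)
    \<comment> \<open>The added condition on \<open>v\<close> is automatic for \<open>S\<close>
      containing \<open>v\<close>; it lets the permutations be regrouped by their kept set.\<close>
    have "sum h (acyclic_sets_at D v)
        = (\<Sum>S\<in>acyclic_sets_at D v.
            \<Sum>As | As \<in> {As \<in> P. v \<in> first_hit_set D As} \<and> first_hit_set D As = S.
              L * sampling_weight g As)"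
      unfolding h_def acyclic_sets_at_def by (intro sum.cong) auto
    also have "\<dots> = (\<Sum>As\<in>{As \<in> P. v \<in> first_hit_set D As}. L * sampling_weight g As)"
      using finP fin hit_acyclic by (intro sum.group) (auto simp: acyclic_sets_at_def)
    also have "\<dots> = L * (\<Sum>As\<in>P. sampling_weight g As * of_bool (v \<in> first_hit_set D As))"
      using finP unfolding sum_distrib_left by (subst sum.inter_filter) (auto intro!: sum.cong)
    finally have sum_h: "sum h (acyclic_sets_at D v)
        = L * (\<Sum>As\<in>P. sampling_weight g As * of_bool (v \<in> first_hit_set D As))" .
    \<comment> \<open>Every set containing \<open>v\<close> meets its closed in-neighborhood, and
      acyclic sets outside \<open>F\<close> weigh nothing.\<close>
    have at_F: "sum g {A \<in> F. ?Q A \<and> v \<in> A} = sum g (acyclic_sets_at D v)"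
      using fin v_nbhd zero
      by (intro sum.mono_neutral_left) (auto simp: acyclic_sets_at_def F_def)
    have nbhd_F: "sum g {A \<in> F. ?Q A} = nbhd_weight D g v"
      unfolding nbhd_weight_def using fin zero
      by (intro sum.mono_neutral_left) (auto simp: F_def)
    have ge1: "1 \<le> sum g {A \<in> F. ?Q A \<and> v \<in> A}"
      using g v by (simp add: at_F frac_colorings_def)
    then have "{A \<in> F. ?Q A \<and> v \<in> A} \<noteq> {}" by (metis sum.empty not_one_le_zero)
    then have "\<exists>A\<in>F. ?Q A" by blast
    then have "(\<Sum>As\<in>P. sampling_weight g As * of_bool (v \<in> first_hit_set D As))
        = sum g {A \<in> F. ?Q A \<and> v \<in> A} / sum g {A \<in> F. ?Q A}"
      using sum_sampling_weight_find[OF finF, of g ?Q "\<lambda>A. v \<in> A"] v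
      by (simp add: P_def F_def first_hit_set_def)
    then have eq: "sum h (acyclic_sets_at D v)
        = L * sum g {A \<in> F. ?Q A \<and> v \<in> A} / nbhd_weight D g v"
      by (simp add: sum_h nbhd_F)
    have "sum g {A \<in> F. ?Q A \<and> v \<in> A} \<le> sum g {A \<in> F. ?Q A}"
      using fin by (intro sum_mono2) (auto simp: F_def)
    then have pos: "0 < nbhd_weight D g v" using ge1 nbhd_F by linarith
    \<comment> \<open>In the ratio \<open>eq\<close> the denominator is at most \<open>L\<close> and
      the numerator at least \<open>L\<close>.\<close>
    have "nbhd_weight D g v \<le> L"
      unfolding L_def using assms(1) v by (rule nbhd_weight_le_local_weight)
    also have "\<dots> \<le> L * sum g {A \<in> F. ?Q A \<and> v \<in> A}"
      using ge1 L_nonneg by (simp add: mult_le_cancel_left1)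
    finally show ?thesis using pos by (simp add: eq)
  qed
  have "total_weight D (\<lambda>S. min 1 (h S)) \<le> total_weight D h"
    unfolding total_weight_def by (intro sum_mono) simp
  then show ?thesis
    using frac_coloring_cutoff[OF assms(1) h_nonneg cover] total
    by (auto simp: L_def)
qed

theorem lemma4:
  fixes D :: "('a, 'b) pre_digraph"
  assumes "digraph D"
  shows "frac_local_dichromatic D = frac_dichromatic D"
proof (rule antisym)
  obtain g where g: "g \<in> frac_colorings D" "frac_dichromatic D = total_weight D g"
    "\<And>h. h \<in> frac_colorings D \<Longrightarrow> total_weight D g \<le> total_weight D h"
    using frac_dichromatic_is_min[OF assms] by blast
  obtain l where l: "l \<in> frac_colorings D" "frac_local_dichromatic D = local_weight D l"
    "\<And>h. h \<in> frac_colorings D \<Longrightarrow> local_weight D l \<le> local_weight D h"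
    using frac_local_dichromatic_is_min[OF assms] by blast
  \<comment> \<open>The minimizer \<open>g\<close> of the total weight bounds the local minimum
    directly; for the converse, \<open>l\<close> is first turned into \<open>h\<close>.\<close>
  show "frac_local_dichromatic D \<le> frac_dichromatic D"
    using l(3)[OF g(1)] local_weight_le_total_weight[OF assms g(1)] g(2) l(2) by simp
  obtain h where "h \<in> frac_colorings D" "total_weight D h \<le> local_weight D l"
    using exists_frac_coloring_total_weight_le[OF assms l(1)] by blast
  then show "frac_dichromatic D \<le> frac_local_dichromatic D"
    using g(2,3) l(2) by fastforce
qed

end
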